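(* Let $f:\mathbb{N}\to\mathbb{N}$ be a function. Then there exists a pair of groups $\Gamma<G$, with $c_n(\Gamma,G)$ finite for every $n\in\mathbb{N}$, such that $c_{\leq n}(\Gamma,G)\geq f(n)$ for all $n\in\mathbb{N}$.
   Context: For a group $G$, a subgroup $A\subset G$ and $g\in G$, write $A^g=g^{-1}Ag$. The commensurizer $\mathrm{Comm}(A,G)$ is the set of $g\in G$ such that $A\cap A^g$ has finite index in both $A$ and $A^g$. For a positive integer $n$, $\mathrm{Comm}_n(A,G)=\{g\in \mathrm{Comm}(A,G): [A:A\cap A^g]=n\}$; $c_n(A,G)=|N_G(A)\backslash \mathrm{Comm}_n(A,G)|$, where the normalizer $N_G(A)$ acts by left multiplication; and $c_{\leq n}(A,G)=c_1(A,G)+\dots+c_n(A,G)$.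
   Formalization: The inequality at n=1 is claimed only when f(1) ≤ 1, because finiteness of c_1(Γ,G) forces c_1(Γ,G)=1, so the statement fails for f(1) ≥ 2; for all n ≥ 2 and every f it is unchanged. *)

theory Defs
  imports "HOL-Algebra.Algebra"
begin

definition conj_subgroup :: "('a, 'b) monoid_scheme \<Rightarrow> 'a set \<Rightarrow> 'a \<Rightarrow> 'a set"
  where "conj_subgroup G A g = inv\<^bsub>G\<^esub> g <#\<^bsub>G\<^esub> A #>\<^bsub>G\<^esub> g"

definition cosets_in :: "('a, 'b) monoid_scheme \<Rightarrow> 'a set \<Rightarrow> 'a set \<Rightarrow> 'a set set"
  where "cosets_in G A B = rcosets\<^bsub>G\<lparr>carrier := A\<rparr>\<^esub> B"

definition finite_index :: "('a, 'b) monoid_scheme \<Rightarrow> 'a set \<Rightarrow> 'a set \<Rightarrow> bool"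
  where "finite_index G A B \<longleftrightarrow> finite (cosets_in G A B)"

(* The index [A : B]; only meaningful when finite_index G A B holds, since card is 0
   on infinite sets. *)
definition subgroup_index :: "('a, 'b) monoid_scheme \<Rightarrow> 'a set \<Rightarrow> 'a set \<Rightarrow> nat"
  where "subgroup_index G A B = card (cosets_in G A B)"

definition Comm :: "'a set \<Rightarrow> ('a, 'b) monoid_scheme \<Rightarrow> 'a set"
  where "Comm A G = {g \<in> carrier G.
    finite_index G A (A \<inter> conj_subgroup G A g) \<and>
    finite_index G (conj_subgroup G A g) (A \<inter> conj_subgroup G A g)}"

definition Comm_n :: "nat \<Rightarrow> 'a set \<Rightarrow> ('a, 'b) monoid_scheme \<Rightarrow> 'a set"
  where "Comm_n n A G = {g \<in> Comm A G. subgroup_index G A (A \<inter> conj_subgroup G A g) = n}"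

definition Comm_quotient :: "nat \<Rightarrow> 'a set \<Rightarrow> ('a, 'b) monoid_scheme \<Rightarrow> 'a set set"
  where "Comm_quotient n A G =
    orbits (G\<lparr>carrier := normalizer G A\<rparr>) (Comm_n n A G) (\<lambda>h g. h \<otimes>\<^bsub>G\<^esub> g)"

definition c_finite :: "nat \<Rightarrow> 'a set \<Rightarrow> ('a, 'b) monoid_scheme \<Rightarrow> bool"
  where "c_finite n A G \<longleftrightarrow> finite (Comm_quotient n A G)"

(* The value c_n; only meaningful when c_finite n A G holds. *)
definition c_eq :: "nat \<Rightarrow> 'a set \<Rightarrow> ('a, 'b) monoid_scheme \<Rightarrow> nat"
  where "c_eq n A G = card (Comm_quotient n A G)"

definition c_le :: "nat \<Rightarrow> 'a set \<Rightarrow> ('a, 'b) monoid_scheme \<Rightarrow> nat"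
  where "c_le n A G = (\<Sum>k = 1..n. c_eq k A G)"

(* If c_1(A, G) is finite then c_1(A, G) = 1. Indeed g is in Comm_1 iff A <= A^g with finite
   index; then A <= A^g <= A^(g^2) <= ..., with every g^k in Comm_1, and the orbit of g^k
   determines A^(g^k). Finitely many orbits force A^(g^i) = A^(g^j) for some i < j, hence
   A^g = A, so Comm_1 is the normalizer of A, a single orbit. Therefore a lower bound
   f n <= c_le n A G can hold at n = 1 only if f 1 <= 1; at n >= 2 there is no such
   obstruction. *)

end

theory Submission
  imports Defs
begin

text \<open>
  Let \<open>G\<close> be the group of all permutations of a countable set that preserve every member of a
  family of disjoint finite blocks of size at least 3, and let \<open>\<Gamma>\<close> be the stabilizer of one chosen
  base point in each block. Then \<open>\<Gamma>\<close> fixes no other point of the blocks and is therefore its own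
  normalizer, and the coset \<open>\<Gamma> g\<close> is determined by the points to which the inverse of \<open>g\<close> sends the
  base points. If \<open>g\<close> moves the base point of a block of size \<open>m + 1\<close>, then \<open>\<Gamma>\<close> permutes the
  \<open>m\<close> other points of that block transitively, so the index of \<open>\<Gamma> \<inter> \<Gamma>\<^sup>g\<close> is at least \<open>m\<close>, with
  equality if \<open>g\<close> is a transposition inside the block. Hence \<open>c\<^sub>n\<close> is finite as soon as there are
  only finitely many blocks of each size, and it is at least the number of blocks of size
  \<open>n + 1\<close>, which can be prescribed arbitrarily for \<open>n \<ge> 2\<close>.
\<close>

section \<open>Counting images and cosets\<close>

text \<open>On \<open>A\<close> the map \<open>E\<close> factors through \<open>F\<close>, via a
  choice of preimages. Applied with cosets and points in both roles, it turns the lemmas relating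
  cosets and points into bounds on indices.\<close>

lemma card_image_factor:
  assumes "\<And>x y. x \<in> A \<Longrightarrow> y \<in> A \<Longrightarrow> F x = F y \<Longrightarrow> E x = E y" and "finite (F ` A)"
  shows "finite (E ` A)" and "card (E ` A) \<le> card (F ` A)"
proof -
  have "E x = E (inv_into A F (F x))" if "x \<in> A" for x
    using that by (intro assms(1)) (auto intro: inv_into_into simp: f_inv_into_f)
  then have eq: "E ` A = (\<lambda>z. E (inv_into A F z)) ` F ` A"
    by (force simp: image_image)
  show "finite (E ` A)" "card (E ` A) \<le> card (F ` A)"
    unfolding eq using assms(2) by (auto intro: card_image_le)
qed

lemma cosets_in_image: "cosets_in G A B = (\<lambda>a. B #>\<^bsub>G\<^esub> a) ` A"
  unfolding cosets_in_def RCOSETS_def r_coset_def by auto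

section \<open>Permutations preserving blocks, and the stabilizer of the base points\<close>

locale based_blocks =
  fixes J :: "'j set" and W :: "'j \<Rightarrow> 'a set" and b :: "'j \<Rightarrow> 'a"
  assumes disjoint: "\<And>i j x. i \<in> J \<Longrightarrow> j \<in> J \<Longrightarrow> x \<in> W i \<Longrightarrow> x \<in> W j \<Longrightarrow> i = j"
    and base: "\<And>j. j \<in> J \<Longrightarrow> b j \<in> W j"
    and finite_block: "\<And>j. j \<in> J \<Longrightarrow> finite (W j)"
    and card_block: "\<And>j. j \<in> J \<Longrightarrow> 3 \<le> card (W j)"
begin

text \<open>The elements are bijections of the whole type, free to move points outside the blocks,
  so that inverses are simply \<open>inv_into UNIV\<close>.\<close>

definition block_group :: "('a \<Rightarrow> 'a) monoid" where
  "block_group = \<lparr>carrier = {g. bij g \<and> (\<forall>j\<in>J. g ` W j = W j)}, monoid.mult = (\<circ>), one = id\<rparr>"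

definition base_stabilizer :: "('a \<Rightarrow> 'a) set" where
  "base_stabilizer = {g \<in> carrier block_group. \<forall>j\<in>J. g (b j) = b j}"

lemma mult_block_group [simp]: "g \<otimes>\<^bsub>block_group\<^esub> h = g \<circ> h"
  and one_block_group [simp]: "\<one>\<^bsub>block_group\<^esub> = id"
  by (simp_all add: block_group_def)

lemma carrier_block_group:
  "g \<in> carrier block_group \<longleftrightarrow> bij g \<and> (\<forall>j\<in>J. g ` W j = W j)"
  by (simp add: block_group_def)

lemma inv_into_closed:
  assumes "g \<in> carrier block_group"
  shows "inv_into UNIV g \<in> carrier block_group"
proof -
  have "inv_into UNIV g ` W j = W j" if "j \<in> J" for j
    using assms that by (metis carrier_block_group bij_is_inj image_inv_f_f)
  then show ?thesis
    using assms by (simp add: carrier_block_group bij_imp_bij_inv)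
qed

lemma inv_into_apply:
  assumes "g \<in> carrier block_group"
  shows "g (inv_into UNIV g x) = x" and "inv_into UNIV g (g x) = x"
    and "g \<circ> inv_into UNIV g = id" and "inv_into UNIV g \<circ> g = id"
  using assms by (auto simp: carrier_block_group bij_is_inj bij_is_surj surj_f_inv_f fun_eq_iff)

lemma group_block_group: "group block_group"
proof (rule groupI)
  fix g assume "g \<in> carrier block_group"
  then show "\<exists>h\<in>carrier block_group. h \<otimes>\<^bsub>block_group\<^esub> g = \<one>\<^bsub>block_group\<^esub>"
    using inv_into_closed inv_into_apply(4) by auto
next
  fix g h assume "g \<in> carrier block_group" "h \<in> carrier block_group"
  moreover from this have "(g \<circ> h) ` W j = W j" if "j \<in> J" for j
    using that by (simp only: carrier_block_group image_comp [symmetric])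
  ultimately show "g \<otimes>\<^bsub>block_group\<^esub> h \<in> carrier block_group"
    unfolding mult_block_group carrier_block_group by (blast intro: bij_comp)
qed (auto simp: carrier_block_group o_assoc)

sublocale group block_group
  by (rule group_block_group)

lemma m_inv_block_group:
  "g \<in> carrier block_group \<Longrightarrow> inv\<^bsub>block_group\<^esub> g = inv_into UNIV g"
  by (rule inv_equality) (auto simp: inv_into_apply inv_into_closed)

lemma apply_mem_block:
  "g \<in> carrier block_group \<Longrightarrow> j \<in> J \<Longrightarrow> g x \<in> W j \<longleftrightarrow> x \<in> W j"
  by (metis bij_is_inj carrier_block_group inj_image_mem_iff)

text \<open>By disjointness, every other block contains neither of the two swapped points.\<close>

lemma transpose_mem:
  assumes "j \<in> J" "x \<in> W j" "y \<in> W j"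
  shows "transpose x y \<in> carrier block_group"
proof -
  have "transpose x y ` W i = W i" if "i \<in> J" for i
    using disjoint[OF that \<open>j \<in> J\<close>] assms by (intro transpose_image_eq) auto
  then show ?thesis
    by (simp add: carrier_block_group)
qed

lemma transpose_mem_base_stabilizer:
  assumes "j \<in> J" "x \<in> W j - {b j}" "y \<in> W j - {b j}"
  shows "transpose x y \<in> base_stabilizer"
proof -
  have "transpose x y (b i) = b i" if "i \<in> J" for i
    using disjoint[OF that \<open>j \<in> J\<close>] base[OF that] assms by (auto simp: transpose_def)
  then show ?thesis
    using assms transpose_mem[of j x y] by (simp add: base_stabilizer_def)
qed

lemma subgroup_base_stabilizer: "subgroup base_stabilizer block_group"
proof (rule subgroupI)
  fix g assume "g \<in> base_stabilizer"
  then show "inv\<^bsub>block_group\<^esub> g \<in> base_stabilizer"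
    by (auto simp: base_stabilizer_def m_inv_block_group inv_into_closed)
      (metis inv_into_apply(2))
next
  have "id \<in> base_stabilizer"
    by (simp add: base_stabilizer_def carrier_block_group)
  then show "base_stabilizer \<noteq> {}" by auto
next
  fix g h assume "g \<in> base_stabilizer" "h \<in> base_stabilizer"
  then show "g \<otimes>\<^bsub>block_group\<^esub> h \<in> base_stabilizer"
    using m_closed[of g h] by (simp add: base_stabilizer_def)
qed (auto simp: base_stabilizer_def)

section \<open>Conjugates, cosets and orbits of points\<close>

text \<open>A conjugate of a stabilizer is the stabilizer of the translated points: \<open>h\<close>
  fixes \<open>b j\<close> iff g^-1 h g fixes g^-1 (b j).\<close>

lemma conj_base_stabilizer:
  assumes g: "g \<in> carrier block_group"
  shows "conj_subgroup block_group base_stabilizer g =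
    {h \<in> carrier block_group. \<forall>j\<in>J. h (inv_into UNIV g (b j)) = inv_into UNIV g (b j)}"
    (is "_ = ?R")
proof -
  let ?i = "inv_into UNIV g"
  have conj: "conj_subgroup block_group base_stabilizer g = (\<lambda>h. ?i \<circ> h \<circ> g) ` base_stabilizer"
    by (auto simp: conj_subgroup_def l_coset_def r_coset_def m_inv_block_group[OF g])
  have "?i \<circ> h \<circ> g \<in> ?R" if "h \<in> base_stabilizer" for h
    using that g inv_into_closed[OF g] m_closed[of "?i \<circ> h" g] m_closed[of ?i h]
    by (simp add: base_stabilizer_def inv_into_apply)
  moreover have "h \<in> (\<lambda>h. ?i \<circ> h \<circ> g) ` base_stabilizer" if h: "h \<in> ?R" for h
  proof (rule image_eqI)
    show "h = ?i \<circ> (g \<circ> h \<circ> ?i) \<circ> g"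
      using g by (simp add: fun_eq_iff inv_into_apply)
    show "g \<circ> h \<circ> ?i \<in> base_stabilizer"
      using h g inv_into_closed[OF g] m_closed[of "g \<circ> h" ?i] m_closed[of g h]
      by (simp add: base_stabilizer_def inv_into_apply)
  qed
  ultimately show ?thesis
    unfolding conj by blast
qed

text \<open>If x = h y and \<open>h\<close> fixes \<open>p\<close>, then x^-1 p = y^-1 p. Thus
  different preimages of \<open>p\<close> give different right cosets, which bounds indices from
  below.\<close>

lemma coset_eq_imp_point_eq:
  assumes "x \<in> carrier block_group" "y \<in> carrier block_group"
    and "id \<in> H" "\<And>h. h \<in> H \<Longrightarrow> h p = p \<and> h \<in> carrier block_group"
    and "H #>\<^bsub>block_group\<^esub> x = H #>\<^bsub>block_group\<^esub> y"
  shows "inv_into UNIV x p = inv_into UNIV y p"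
proof -
  have "x \<in> H #>\<^bsub>block_group\<^esub> y"
    unfolding assms(5)[symmetric] unfolding r_coset_def
    using assms(3) by (intro UN_I[of id]) simp_all
  then obtain h where h: "h \<in> H" "x = h \<circ> y"
    by (auto simp: r_coset_def)
  have "x (inv_into UNIV y p) = p"
    using h assms(2,4) by (simp add: inv_into_apply)
  then show ?thesis
    using assms(1) by (metis inv_into_apply(2))
qed

text \<open>This is the other half of the orbit-stabilizer correspondence, for the full stabilizer
  of \<open>p\<close> in \<open>K\<close>; it bounds indices from above.\<close>

lemma point_eq_imp_coset_eq:
  assumes K: "subgroup K block_group" and "x \<in> K" "y \<in> K"
    and eq: "inv_into UNIV x p = inv_into UNIV y p"
  shows "{h \<in> K. h p = p} #>\<^bsub>block_group\<^esub> x = {h \<in> K. h p = p} #>\<^bsub>block_group\<^esub> y"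
proof -
  have *: "{h \<in> K. h p = p} #>\<^bsub>block_group\<^esub> x \<subseteq> {h \<in> K. h p = p} #>\<^bsub>block_group\<^esub> y"
    if xy: "x \<in> K" "y \<in> K" and eq: "inv_into UNIV x p = inv_into UNIV y p" for x y
  proof
    fix z assume "z \<in> {h \<in> K. h p = p} #>\<^bsub>block_group\<^esub> x"
    then obtain h where h: "h \<in> K" "h p = p" "z = h \<circ> x"
      by (auto simp: r_coset_def)
    have car: "x \<in> carrier block_group" "y \<in> carrier block_group"
      using xy K by (auto dest: subgroup.mem_carrier)
    \<comment> \<open>This is the only \<open>k\<close> with h x = k y; it fixes \<open>p\<close>
      because y^-1 p = x^-1 p.\<close>
    define k where "k = h \<circ> x \<circ> inv_into UNIV y"
    have "k \<in> K"
      using subgroup.m_closed[OF K subgroup.m_closed[OF K h(1) xy(1)]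
          subgroup.m_inv_closed[OF K xy(2)]] car
      by (simp add: k_def m_inv_block_group)
    moreover have "k p = p"
      using h car by (simp add: k_def eq [symmetric] inv_into_apply)
    moreover have "z = k \<circ> y"
      using h car by (simp add: k_def fun_eq_iff inv_into_apply)
    ultimately show "z \<in> {h \<in> K. h p = p} #>\<^bsub>block_group\<^esub> y"
      by (auto simp: r_coset_def)
  qed
  show ?thesis
    using *[of x y] *[of y x] assms by auto
qed

text \<open>Inverses appear because right cosets correspond to preimages of points. Transitivity
  comes from transpositions, which are their own inverses.\<close>

lemma base_stabilizer_orbit:
  assumes "j \<in> J" "p \<in> W j - {b j}"
  shows "(\<lambda>x. inv_into UNIV x p) ` base_stabilizer = W j - {b j}"
proof
  show "(\<lambda>x. inv_into UNIV x p) ` base_stabilizer \<subseteq> W j - {b j}"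
  proof clarify
    fix x assume x: "x \<in> base_stabilizer"
    then have "inv_into UNIV x \<in> carrier block_group" "x (inv_into UNIV x p) = p"
      by (auto simp: base_stabilizer_def inv_into_closed inv_into_apply)
    then show "inv_into UNIV x p \<in> W j - {b j}"
      using assms x by (auto simp: apply_mem_block base_stabilizer_def)
  qed
  show "W j - {b j} \<subseteq> (\<lambda>x. inv_into UNIV x p) ` base_stabilizer"
  proof
    fix q assume "q \<in> W j - {b j}"
    then have "transpose p q \<in> base_stabilizer"
      using assms by (intro transpose_mem_base_stabilizer)
    then show "q \<in> (\<lambda>x. inv_into UNIV x p) ` base_stabilizer"
      by (rule rev_image_eqI) simp
  qed
qed

section \<open>The normalizer\<close>

text \<open>A normalizing \<open>n\<close> sends \<open>b j\<close> to a point fixed by all of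
  \<open>base_stabilizer\<close>. If this point were not \<open>b j\<close>, it could be swapped
  with a third point of the block while all base points stay fixed.\<close>

lemma normalizer_base_stabilizer: "normalizer block_group base_stabilizer = base_stabilizer"
proof
  have sub: "base_stabilizer \<subseteq> carrier block_group"
    by (auto simp: base_stabilizer_def)
  show "base_stabilizer \<subseteq> normalizer block_group base_stabilizer"
  proof
    fix n assume n: "n \<in> base_stabilizer"
    then show "n \<in> normalizer block_group base_stabilizer"
      using sub subgroup_base_stabilizer coset_join3[of n] coset_join2[of "inv\<^bsub>block_group\<^esub> n"]
      by (auto simp: normalizer_def stabilizer_def subgroup.m_inv_closed)
  qed
  show "normalizer block_group base_stabilizer \<subseteq> base_stabilizer"
  proof
    fix n assume "n \<in> normalizer block_group base_stabilizer"
    then have n: "n \<in> carrier block_group"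
      and "n <#\<^bsub>block_group\<^esub> base_stabilizer #>\<^bsub>block_group\<^esub> inv\<^bsub>block_group\<^esub> n = base_stabilizer"
      using sub by (auto simp: normalizer_def stabilizer_def)
    \<comment> \<open>\<open>normalizer\<close> conjugates as n A n^-1 and
      \<open>conj_subgroup\<close> as g^-1 A g, hence the inverse. The points fixed by this
      conjugate are then the \<open>n (b j)\<close>.\<close>
    then have "conj_subgroup block_group base_stabilizer (inv\<^bsub>block_group\<^esub> n) = base_stabilizer"
      by (simp add: conj_subgroup_def)
    moreover have "inv_into UNIV (inv_into UNIV n) = n"
      using n by (simp add: carrier_block_group inv_inv_eq)
    ultimately have fixes_base: "h (n (b j)) = n (b j)" if "h \<in> base_stabilizer" "j \<in> J" for h j
      using that conj_base_stabilizer[OF inv_into_closed[OF n]]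
      by (auto simp: m_inv_block_group[OF n])
    have "n (b j) = b j" if j: "j \<in> J" for j
    proof (rule ccontr)
      assume ne: "n (b j) \<noteq> b j"
      have nb: "n (b j) \<in> W j"
        using n j base by (simp add: apply_mem_block)
      \<comment> \<open>Block size at least 3 leaves room for the third point
        \<open>q\<close>.\<close>
      have "card {b j, n (b j)} < card (W j)"
        using card_block[OF j] by (simp add: card_insert_if)
      then obtain q where q: "q \<in> W j" "q \<noteq> b j" "q \<noteq> n (b j)"
        by (metis card_mono finite.emptyI finite_insert insertCI not_le subsetI)
      then have "transpose (n (b j)) q \<in> base_stabilizer"
        using nb ne j by (intro transpose_mem_base_stabilizer) auto
      from fixes_base[OF this j] show False
        using q by simp
    qed
    then show "n \<in> base_stabilizer"
      using n by (simp add: base_stabilizer_def)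
  qed
qed

section \<open>Index bounds and finiteness of the orbit count\<close>

lemma id_mem: "id \<in> base_stabilizer \<inter> conj_subgroup block_group base_stabilizer g"
  if "g \<in> carrier block_group"
  using one_closed that by (simp add: conj_base_stabilizer) (simp add: base_stabilizer_def)

text \<open>The intersection fixes p = g^-1 (b j), so its cosets in \<open>base_stabilizer\<close>
  are at least as many as the points in the orbit of \<open>p\<close>, which is the block without
  its base point.\<close>

lemma card_block_le_if_moves_base:
  assumes g: "g \<in> Comm_n n base_stabilizer block_group"
    and j: "j \<in> J" and moves: "inv_into UNIV g (b j) \<noteq> b j"
  shows "card (W j) \<le> Suc n"
proof -
  let ?H = "base_stabilizer \<inter> conj_subgroup block_group base_stabilizer g"
  let ?p = "inv_into UNIV g (b j)"
  have gc: "g \<in> carrier block_group"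
    and fin: "finite ((\<lambda>x. ?H #>\<^bsub>block_group\<^esub> x) ` base_stabilizer)"
    and card: "card ((\<lambda>x. ?H #>\<^bsub>block_group\<^esub> x) ` base_stabilizer) = n"
    using g by (auto simp: Comm_n_def Comm_def finite_index_def subgroup_index_def cosets_in_image)
  have p: "?p \<in> W j - {b j}"
    using moves base[OF j] apply_mem_block[OF inv_into_closed[OF gc] j] by auto
  have "card (W j - {b j}) \<le> n"
    unfolding base_stabilizer_orbit[OF j p, symmetric] card[symmetric]
  proof (rule card_image_factor(2)[OF _ fin])
    fix x y assume "x \<in> base_stabilizer" "y \<in> base_stabilizer"
      and "?H #>\<^bsub>block_group\<^esub> x = ?H #>\<^bsub>block_group\<^esub> y"
    then show "inv_into UNIV x ?p = inv_into UNIV y ?p"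
      using gc id_mem[OF gc] j subgroup.mem_carrier[OF subgroup_base_stabilizer]
      by (intro coset_eq_imp_point_eq[of x y ?H]) (auto simp: conj_base_stabilizer)
  qed
  then show ?thesis
    using finite_block[OF j] base[OF j] by (simp add: card_Diff_singleton)
qed

text \<open>Since the subgroup is its own normalizer, the orbits under left multiplication are its
  right cosets.\<close>

lemma Comm_quotient_eq:
  "Comm_quotient n base_stabilizer block_group =
    (\<lambda>g. base_stabilizer #>\<^bsub>block_group\<^esub> g) ` Comm_n n base_stabilizer block_group"
  unfolding Comm_quotient_def orbits_def orbit_def normalizer_base_stabilizer
  by (auto simp: r_coset_def image_def)

text \<open>Under the last assumption x y^-1 sends \<open>b j\<close> to x (x^-1 (b j)) = b
  j.\<close>

lemma base_stabilizer_coset_eqI: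
  assumes "x \<in> carrier block_group" "y \<in> carrier block_group"
    and "\<And>j. j \<in> J \<Longrightarrow> inv_into UNIV x (b j) = inv_into UNIV y (b j)"
  shows "base_stabilizer #>\<^bsub>block_group\<^esub> x = base_stabilizer #>\<^bsub>block_group\<^esub> y"
proof (rule coset_mult_inv1)
  have "x \<circ> inv_into UNIV y \<in> base_stabilizer"
    using assms m_closed[of x "inv_into UNIV y"] inv_into_closed[of y]
    by (simp add: base_stabilizer_def assms(3)[symmetric] inv_into_apply)
  then show "base_stabilizer #>\<^bsub>block_group\<^esub> (x \<otimes>\<^bsub>block_group\<^esub> inv\<^bsub>block_group\<^esub> y) = base_stabilizer"
    using assms m_closed[of x "inv_into UNIV y"] inv_into_closed[of y]
    by (intro coset_join2 subgroup_base_stabilizer) (auto simp: m_inv_block_group)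
qed (use assms in \<open>auto simp: base_stabilizer_def\<close>)

text \<open>Within \<open>Comm_n\<close> the inverse of \<open>g\<close> fixes the base point of
  every block with more than n + 1 points, so the coset of \<open>g\<close> is determined by what
  happens on the finitely many smaller blocks.\<close>

lemma c_finite_block_group:
  assumes fin: "finite {j \<in> J. card (W j) \<le> Suc n}" (is "finite ?S")
  shows "c_finite n base_stabilizer block_group"
  unfolding c_finite_def Comm_quotient_eq
proof (rule card_image_factor(1))
  \<comment> \<open>Restricting to the small blocks places these functions in a finite product of
    finite sets.\<close>
  let ?F = "\<lambda>g. restrict (\<lambda>j. inv_into UNIV g (b j)) ?S"
  have "?F ` Comm_n n base_stabilizer block_group \<subseteq> Pi\<^sub>E ?S W"
    using base unfolding Comm_n_def Comm_def
    by (intro image_subsetI restrict_PiE_iff[THEN iffD2])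
      (auto simp: apply_mem_block[OF inv_into_closed])
  moreover have "finite (Pi\<^sub>E ?S W)"
    using fin finite_block by (intro finite_PiE) auto
  ultimately show "finite (?F ` Comm_n n base_stabilizer block_group)"
    by (rule finite_subset)
  fix x y
  assume x: "x \<in> Comm_n n base_stabilizer block_group"
    and y: "y \<in> Comm_n n base_stabilizer block_group" and eq: "?F x = ?F y"
  show "base_stabilizer #>\<^bsub>block_group\<^esub> x = base_stabilizer #>\<^bsub>block_group\<^esub> y"
  proof (rule base_stabilizer_coset_eqI)
    fix j assume j: "j \<in> J"
    show "inv_into UNIV x (b j) = inv_into UNIV y (b j)"
    proof (cases "j \<in> ?S")
      case True
      then show ?thesis using fun_cong[OF eq, of j] by simp
    next
      case False
      then have "inv_into UNIV x (b j) = b j" "inv_into UNIV y (b j) = b j"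
        using j card_block_le_if_moves_base[OF x j] card_block_le_if_moves_base[OF y j] by blast+
      then show ?thesis by simp
    qed
  qed (use x y in \<open>auto simp: Comm_n_def Comm_def\<close>)
qed

section \<open>Elements of prescribed index\<close>

lemma id_mem_Comm_n: "id \<in> Comm_n 1 base_stabilizer block_group"
proof -
  have conj: "conj_subgroup block_group base_stabilizer id = base_stabilizer"
    using conj_base_stabilizer[of id] one_closed by (simp add: base_stabilizer_def)
  have "(\<lambda>a. base_stabilizer #>\<^bsub>block_group\<^esub> a) ` base_stabilizer = {base_stabilizer}"
  proof -
    have "base_stabilizer #>\<^bsub>block_group\<^esub> a = base_stabilizer" if "a \<in> base_stabilizer" for a
      using that subgroup_base_stabilizer by (intro coset_join2) (auto dest: subgroup.mem_carrier)
    moreover have "base_stabilizer \<noteq> {}"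
      using subgroup.one_closed[OF subgroup_base_stabilizer] by blast
    ultimately show ?thesis by auto
  qed
  then show ?thesis
    using one_closed
    by (simp add: Comm_n_def Comm_def conj finite_index_def subgroup_index_def cosets_in_image)
qed

text \<open>The conjugate differs from \<open>base_stabilizer\<close> only in block
  \<open>j\<close>, where it fixes \<open>c\<close> instead of \<open>b j\<close>. The index is
  therefore the size of the orbit of \<open>c\<close>, which has \<open>n\<close> points.\<close>

lemma transpose_mem_Comm_n:
  assumes j: "j \<in> J" and c: "c \<in> W j - {b j}" and card: "card (W j) = Suc n"
  shows "transpose (b j) c \<in> Comm_n n base_stabilizer block_group"
proof -
  let ?t = "transpose (b j) c"
  let ?C = "conj_subgroup block_group base_stabilizer ?t"
  have t: "?t \<in> carrier block_group"
    using j c base by (auto intro: transpose_mem)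
  have t_base: "?t (b i) = (if i = j then c else b i)" if "i \<in> J" for i
    using disjoint[OF that j] base[OF that] base[OF j] c by (auto simp: transpose_def)
  have C: "?C = {h \<in> carrier block_group. \<forall>i\<in>J. h (?t (b i)) = ?t (b i)}"
    using conj_base_stabilizer[OF t] by simp
  \<comment> \<open>The intersection is a point stabilizer in each of the two groups, the form that
    \<open>point_eq_imp_coset_eq\<close> requires.\<close>
  have H1: "base_stabilizer \<inter> ?C = {h \<in> base_stabilizer. h c = c}"
    unfolding C using j t_base by (auto simp: base_stabilizer_def)
  have H2: "base_stabilizer \<inter> ?C = {h \<in> ?C. h (b j) = b j}"
    unfolding C using j t_base by (auto simp: base_stabilizer_def split: if_splits)
  have subC: "subgroup ?C block_group"
  proof (rule subgroupI)
    fix g assume "g \<in> ?C"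
    then show "inv\<^bsub>block_group\<^esub> g \<in> ?C"
      unfolding C by (auto simp: m_inv_block_group inv_into_closed) (metis inv_into_apply(2))
  next
    show "?C \<noteq> {}" using id_mem[OF t] by auto
  next
    fix g h assume "g \<in> ?C" "h \<in> ?C"
    then show "g \<otimes>\<^bsub>block_group\<^esub> h \<in> ?C"
      unfolding C using m_closed[of g h] by simp
  qed (auto simp: C)
  let ?F = "\<lambda>x. (base_stabilizer \<inter> ?C) #>\<^bsub>block_group\<^esub> x"
  have orb: "(\<lambda>x. inv_into UNIV x c) ` base_stabilizer = W j - {b j}"
    using j c by (rule base_stabilizer_orbit)
  have finW: "finite (W j - {b j})"
    using finite_block[OF j] by simp
  have fin1: "finite (?F ` base_stabilizer)"
    and le: "card (?F ` base_stabilizer) \<le> card (W j - {b j})"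
    using card_image_factor[of base_stabilizer "\<lambda>x. inv_into UNIV x c" ?F]
      point_eq_imp_coset_eq[OF subgroup_base_stabilizer, of _ _ c] finW
    unfolding orb H1 by blast+
  have "card (W j - {b j}) \<le> card (?F ` base_stabilizer)"
    unfolding orb[symmetric]
  proof (rule card_image_factor(2)[OF _ fin1])
    fix x y assume "x \<in> base_stabilizer" "y \<in> base_stabilizer" and "?F x = ?F y"
    then show "inv_into UNIV x c = inv_into UNIV y c"
      using id_mem[OF t] H1
      by (intro coset_eq_imp_point_eq[of x y "base_stabilizer \<inter> ?C"])
        (auto simp: base_stabilizer_def)
  qed
  with le have index: "card (?F ` base_stabilizer) = n"
    using card finite_block[OF j] base[OF j] by (simp add: card_Diff_singleton)
  \<comment> \<open>In the conjugate only finiteness of the index is required, so it suffices that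
    the orbit of \<open>b j\<close> stays inside a finite block.\<close>
  have "(\<lambda>x. inv_into UNIV x (b j)) ` ?C \<subseteq> W j"
    unfolding C using j base by (auto simp: apply_mem_block[OF inv_into_closed])
  then have "finite ((\<lambda>x. inv_into UNIV x (b j)) ` ?C)"
    using finite_block[OF j] finite_subset by blast
  then have fin2: "finite (?F ` ?C)"
    using card_image_factor(1)[of ?C "\<lambda>x. inv_into UNIV x (b j)" ?F]
      point_eq_imp_coset_eq[OF subC, of _ _ "b j"]
    unfolding H2 by blast
  show ?thesis
    using t fin1 fin2 index
    by (simp add: Comm_n_def Comm_def finite_index_def subgroup_index_def cosets_in_image)
qed

text \<open>Each block of size n + 1 contributes one transposition. Two of them lie in different
  cosets, since the one from block \<open>i\<close> moves \<open>b i\<close> and the other fixes it.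
  Finiteness of the quotient keeps \<open>card\<close> from defaulting to 0.\<close>

lemma card_blocks_le_c_eq:
  assumes fin: "finite {j \<in> J. card (W j) \<le> Suc n}"
  shows "card {j \<in> J. card (W j) = Suc n} \<le> c_eq n base_stabilizer block_group"
proof -
  let ?S = "{j \<in> J. card (W j) = Suc n}"
  have "\<exists>c. c \<in> W j - {b j}" if "j \<in> J" for j
  proof (rule ccontr)
    assume "\<not> ?thesis"
    then have "W j \<subseteq> {b j}" by auto
    then have "card (W j) \<le> 1" using card_mono[of "{b j}"] by simp
    with card_block[OF that] show False by simp
  qed
  then obtain c where c: "\<And>j. j \<in> J \<Longrightarrow> c j \<in> W j - {b j}"
    by metis
  let ?o = "\<lambda>j. base_stabilizer #>\<^bsub>block_group\<^esub> transpose (b j) (c j)"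
  have "inj_on ?o ?S"
  proof (rule inj_onI, rule ccontr)
    fix i j assume ij: "i \<in> ?S" "j \<in> ?S" "?o i = ?o j" "i \<noteq> j"
    then have J: "i \<in> J" "j \<in> J" by auto
    have t: "transpose (b i) (c i) \<in> carrier block_group" "transpose (b j) (c j) \<in> carrier block_group"
      using J c base by (auto intro: transpose_mem)
    have "inv_into UNIV (transpose (b i) (c i)) (b i) = inv_into UNIV (transpose (b j) (c j)) (b i)"
      using J subgroup.one_closed[OF subgroup_base_stabilizer] ij(3)
      by (intro coset_eq_imp_point_eq[OF t, of base_stabilizer]) (auto simp: base_stabilizer_def)
    then have "c i = transpose (b j) (c j) (b i)"
      by simp
    moreover have "b i \<noteq> b j" "b i \<noteq> c j"
      using disjoint[OF J] base[OF J(1)] base[OF J(2)] c[OF J(2)] ij(4) by auto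
    ultimately show False
      using c[OF J(1)] by (simp add: transpose_apply_other)
  qed
  moreover have "?o ` ?S \<subseteq> Comm_quotient n base_stabilizer block_group"
    unfolding Comm_quotient_eq using c by (auto intro!: imageI transpose_mem_Comm_n)
  ultimately show ?thesis
    using c_finite_block_group[OF fin] unfolding c_eq_def c_finite_def
    by (rule card_inj_on_le)
qed

end

section \<open>Choosing the blocks\<close>

theorem theorem1p4:
  fixes f :: "nat \<Rightarrow> nat"
  shows "\<exists>(G :: (nat \<Rightarrow> nat) monoid) \<Gamma>.
    group G \<and> subgroup \<Gamma> G \<and>
    (\<forall>n\<ge>1. c_finite n \<Gamma> G) \<and>
    (\<forall>n\<ge>1. (n = 1 \<longrightarrow> f 1 \<le> 1) \<longrightarrow> c_le n \<Gamma> G \<ge> f n)"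
proof -
  \<comment> \<open>For each n \<ge> 2 there are \<open>f n\<close> blocks indexed by
    \<open>(n, l)\<close>; each has the n + 1 points \<open>pt (n, l) i\<close> with i \<le> n, and
    i = 0 gives the base point.\<close>
  define J where "J = {(n, l). 2 \<le> n \<and> l < f n}"
  define pt where "pt = (\<lambda>(n, l) i. prod_encode (n, prod_encode (l, i)))"
  define W where "W = (\<lambda>j. pt j ` {..fst j})"
  have pt_eq: "pt j i = pt j' i' \<longleftrightarrow> j = j' \<and> i = i'" for j j' i i'
    by (cases j; cases j'; simp add: pt_def prod_encode_eq; blast)
  have card_W: "card (W j) = Suc (fst j)" for j
    by (simp add: W_def card_image inj_on_def pt_eq)
  interpret based_blocks J W "\<lambda>j. pt j 0"
  proof
    show "3 \<le> card (W j)" if "j \<in> J" for j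
      using that by (auto simp: card_W J_def)
  qed (auto simp: W_def pt_eq)
  have fin: "finite {j \<in> J. card (W j) \<le> Suc n}" for n
    by (rule finite_subset[of _ "SIGMA m:{..n}. {..<f m}"]) (auto simp: J_def card_W)
  have "f n \<le> c_le n base_stabilizer block_group" if "1 \<le> n" "n = 1 \<longrightarrow> f 1 \<le> 1" for n
  proof -
    \<comment> \<open>The single summand at \<open>n\<close> already reaches the bound. For n = 1
      there are no blocks of size 2, and the orbit of the identity suffices because f 1 \<le>
      1.\<close>
    have "f n \<le> c_eq n base_stabilizer block_group"
    proof (cases "n = 1")
      case True
      have "Comm_quotient 1 base_stabilizer block_group \<noteq> {}"
        using id_mem_Comm_n by (auto simp: Comm_quotient_eq)
      then have "1 \<le> c_eq 1 base_stabilizer block_group"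
        using c_finite_block_group[OF fin, of 1]
        by (simp add: c_eq_def c_finite_def Suc_le_eq card_gt_0_iff)
      then show ?thesis
        using True that by simp
    next
      case False
      then have "{j \<in> J. card (W j) = Suc n} = Pair n ` {..<f n}"
        using that by (auto simp: J_def card_W)
      then have "f n = card {j \<in> J. card (W j) = Suc n}"
        by (simp add: card_image inj_on_def)
      then show ?thesis
        using card_blocks_le_c_eq[OF fin, of n] by simp
    qed
    also have "\<dots> \<le> c_le n base_stabilizer block_group"
      unfolding c_le_def using that by (intro member_le_sum) auto
    finally show ?thesis .
  qed
  then show ?thesis
    using group_block_group subgroup_base_stabilizer c_finite_block_group[OF fin] by blast
qed

end
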